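(* Let $m\ge 2$ be even, and let $\chi^m_n=\sum_{d\ge0}(-1)^dC^d_n$ be the reduced Euler characteristic of the cell complex $X^m_n$ produced by the Comb Algorithm applied to $\mathrm{Ind}(\Delta^m_n)$, $n\ge0$. Then the sequence $a_n=\chi^m_n$ satisfies $a_0=1$, $a_1=-2$, $a_2=1$ and $a_n=a_{n-3}-a_{n-2}-a_{n-1}$ for $n\ge3$; hence its generating function is $$\sum_{n\ge0}\chi^m_n x^n=\frac{1-x}{1+x+x^2-x^3}.$$
   Context: All graphs are finite and simple; $N(p)$ is the set of neighbors of $p$. $\mathrm{Ind}(G)$ is the independence complex of $G$: the simplicial complex on $V(G)$ whose faces are the independent sets of $G$ (including $\emptyset$); a face with $r$ vertices has dimension $r-1$. $Pa_\ell$ is the path on $\ell$ vertices; $\biguplus$ is disjoint union. Graphs. For $m\ge1,n\ge 1$, $Y^m_n$ is the extended star: a central vertex of degree $m$ with $m$ paths ("tendrils") of $n$ edges each emanating from it; $Y^m_0$ is a single vertex. $\widehat Y^m_n$ consists of two vertices $a,b$ joined by $m$ internally disjoint paths with $n+1$ edges each; the $k$-th vertex away from $a$ on the $j$-th path is $(j,k)$. For $n\ge 1$, $\Delta^m_n$ is $\widehat Y^m_{n+1}$ with $n$ additional vertices $1,\dots,n$ and additional edges $\{k,(j,k)\}$, $\{k,(j,k+1)\}$ for $j\in\{1,\dots,m\}$, $k\in\{1,\dots,n\}$. Also $\Delta^m_0:=\widehat Y^m_1$ and $\Delta^m_{-1}$ is a single vertex. Matching trees. For disjoint $A,B\subseteq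 V(G)$ let $\Sigma(A,B)=\{I\in\mathrm{Ind}(G): A\subseteq I,\ B\cap I=\emptyset\}$. A matching tree starts with the root $\Sigma(\emptyset,\emptyset)$; as long as some leaf $\Sigma(A,B)$ has at least two elements, perform one of: (1) if some $p\in V\setminus(A\cup B)$ has $N(p)\setminus(A\cup B)=\emptyset$, give the leaf one child labeled $\emptyset$ ($p$ is a free vertex); (2) if some $p\in V\setminus(A\cup B)$ has $N(p)\setminus(A\cup B)=\{v\}$, give the leaf one child $\Sigma(A\cup\{v\},B\cup N(v))$; (3) choose $v\in V\setminus(A\cup B)$ and give the leaf two children $\Sigma(A,B\cup\{v\})$ and $\Sigma(A\cup\{v\},B\cup N(v))$. The available graph at a node is the subgraph induced on $V\setminus(A\cup B)$. The critical cells are the faces $A$ for the nonempty final leaves $\Sigma(A,B)$. By discrete Morse theory, $\mathrm{Ind}(G)$ is homotopy equivalent to a cell complex with one $d$-cell for each $d$-dimensional critical cell, plus one extra $0$-cell (the base $0$-cell, present since $\emptyset$ is matched). Trees for auxiliary graphs. Path: repeatedly apply (2) with $p$ an end vertex and $v$ its neighbor, and (1) if an isolated vertex remains. $Y^m_n$ with $n\equiv 0 \bmod 3$: on each tendril in turn apply (2) starting from its leaf ($p$ the leaf, $v$ its neighbor, and so on) until the tendril is exhausted, then apply (1) to the central vertex. $Y^m_n$ with $n\not\equiv0\bmod 3$: apply (3) with $v$ the central vertex, then the path trees to the remaining disjoint paths. $\widehat Y^m_n$: apply (3) with $v=b$; the available graphs are then $Y^m_{n-1}$ and $Y^m_n$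 (centered at $a$), to which the previous trees are applied. Comb Algorithm for $\mathrm{Ind}(\Delta^m_n)$ ($m\ge2$, $n\ge1$): for $k=1,\dots,n$ successively apply (3) with $v=k$ at $\Sigma(\emptyset,\{1,\dots,k-1\})$. Then: at $\Sigma(\{1\},N(1))$ apply (1) with $p=a$; at $\Sigma(\{k\},N(k)\cup\{1,\dots,k-1\})$ for $2\le k\le n-1$, the available graph is $Y^m_{k-1}\biguplus\Delta^m_{n-(k+1)}$, and one applies the tree of $Y^m_{k-1}$ and then, below any nonempty leaf, recursively the Comb Algorithm for $\Delta^m_{n-(k+1)}$ (the tree of $\widehat Y^m_1$ if $n-(k+1)=0$); at $\Sigma(\{n\},N(n)\cup\{1,\dots,n-1\})$ apply (1) with $p=b$; at $\Sigma(\emptyset,\{1,\dots,n\})$ the available graph is $\widehat Y^m_{n+1}$ and one applies its tree. $X^m_n$ ($n\ge1$) is the resulting cell complex, homotopy equivalent to $\mathrm{Ind}(\Delta^m_n)$; $X^m_0:=S^0$ (two $0$-cells). $C^d_n$ is the number of $d$-cells of $X^m_n$ for $d\ge1$, and $C^0_n$ is one less than the number of $0$-cells (so for $n\ge 1$, $C^d_n$ is the number of critical cells of dimension $d$); $C^d_n=0$ if $d<0$ or $n<0$. Because of the convention for $C^0_n$, the reduced Euler characteristic of $X^m_n$ is $\sum_{d\ge0}(-1)^dC^d_n$. *)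

theory Defs
  imports "HOL-Computational_Algebra.Formal_Power_Series"
begin

section \<open>Finite simple graphs and independence complexes\<close>

record 'v graph =
  verts :: "'v set"
  edges :: "'v set set"

definition simple_graph :: "'v graph \<Rightarrow> bool" where
  "simple_graph G \<longleftrightarrow> finite (verts G) \<and> (\<forall>e\<in>edges G. e \<subseteq> verts G \<and> card e = 2)"

definition nbrs :: "'v graph \<Rightarrow> 'v \<Rightarrow> 'v set" where
  "nbrs G p = {q. {p, q} \<in> edges G}"

definition Ind :: "'v graph \<Rightarrow> 'v set set" where
  "Ind G = {I. I \<subseteq> verts G \<and> (\<forall>p\<in>I. \<forall>q\<in>I. {p, q} \<notin> edges G)}"

definition face_dim :: "'v set \<Rightarrow> int" where
  "face_dim I = int (card I) - 1"


section \<open>Matching trees\<close>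

definition Sigma_cells :: "'v graph \<Rightarrow> 'v set \<Rightarrow> 'v set \<Rightarrow> 'v set set" where
  "Sigma_cells G A B = {I \<in> Ind G. A \<subseteq> I \<and> B \<inter> I = {}}"

definition available :: "'v graph \<Rightarrow> 'v set \<Rightarrow> 'v set \<Rightarrow> 'v set" where
  "available G A B = verts G - (A \<union> B)"

text \<open>
  Only the rule applied at each node is stored; the labels \<open>\<Sigma>(A,B)\<close> are recomputed
  from the root downwards.  \<open>Free p\<close> is rule (1), whose only child is the empty leaf;
  \<open>Match p v t\<close> is rule (2); \<open>Split v t0 t1\<close> is rule (3), where \<open>t0\<close> is the subtree at
  \<open>\<Sigma>(A, B \<union> {v})\<close> and \<open>t1\<close> the one at \<open>\<Sigma>(A \<union> {v}, B \<union> N(v))\<close>.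
\<close>
datatype 'v mtree =
    Leaf
  | Free 'v
  | Match 'v 'v "'v mtree"
  | Split 'v "'v mtree" "'v mtree"

fun matching_tree :: "'v graph \<Rightarrow> 'v set \<Rightarrow> 'v set \<Rightarrow> 'v mtree \<Rightarrow> bool" where
  "matching_tree G A B Leaf \<longleftrightarrow> card (Sigma_cells G A B) < 2"
| "matching_tree G A B (Free p) \<longleftrightarrow> 2 \<le> card (Sigma_cells G A B) \<and>
     p \<in> available G A B \<and> nbrs G p \<inter> available G A B = {}"
| "matching_tree G A B (Match p v t) \<longleftrightarrow> 2 \<le> card (Sigma_cells G A B) \<and>
     p \<in> available G A B \<and> nbrs G p \<inter> available G A B = {v} \<and>
     matching_tree G (insert v A) (B \<union> nbrs G v) t"
| "matching_tree G A B (Split v t0 t1) \<longleftrightarrow> 2 \<le> card (Sigma_cells G A B) \<and>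
     v \<in> available G A B \<and>
     matching_tree G A (insert v B) t0 \<and>
     matching_tree G (insert v A) (B \<union> nbrs G v) t1"

fun critical_cells :: "'v graph \<Rightarrow> 'v set \<Rightarrow> 'v set \<Rightarrow> 'v mtree \<Rightarrow> 'v set set" where
  "critical_cells G A B Leaf = (if Sigma_cells G A B \<noteq> {} then {A} else {})"
| "critical_cells G A B (Free p) = {}"
| "critical_cells G A B (Match p v t) = critical_cells G (insert v A) (B \<union> nbrs G v) t"
| "critical_cells G A B (Split v t0 t1) =
     critical_cells G A (insert v B) t0 \<union> critical_cells G (insert v A) (B \<union> nbrs G v) t1"

text \<open>\<open>graft t s\<close> performs \<open>s\<close> below every nonempty leaf of \<open>t\<close>.\<close>
fun graft :: "'v mtree \<Rightarrow> 'v mtree \<Rightarrow> 'v mtree" where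
  "graft Leaf s = s"
| "graft (Free p) s = Free p"
| "graft (Match p v t) s = Match p v (graft t s)"
| "graft (Split v t0 t1) s = Split v (graft t0 s) (graft t1 s)"


section \<open>The graphs\<close>

datatype vertex = End_a | End_b | Tendril nat nat | Spine nat

definition Yhat :: "nat \<Rightarrow> nat \<Rightarrow> vertex graph" where
  "Yhat m n = \<lparr>
     verts = {End_a, End_b} \<union> {Tendril j k | j k. j \<in> {1..m} \<and> k \<in> {1..n}},
     edges = {{End_a, Tendril j 1} | j. j \<in> {1..m}}
           \<union> {{Tendril j k, Tendril j (k + 1)} | j k. j \<in> {1..m} \<and> k \<in> {1..<n}}
           \<union> {{Tendril j n, End_b} | j. j \<in> {1..m}} \<rparr>"

text \<open>For \<open>n = 0\<close> this is \<open>Yhat m 1\<close>.\<close>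
definition Delta :: "nat \<Rightarrow> nat \<Rightarrow> vertex graph" where
  "Delta m n = \<lparr>
     verts = verts (Yhat m (n + 1)) \<union> Spine ` {1..n},
     edges = edges (Yhat m (n + 1))
           \<union> {{Spine k, Tendril j k} | j k. j \<in> {1..m} \<and> k \<in> {1..n}}
           \<union> {{Spine k, Tendril j (k + 1)} | j k. j \<in> {1..m} \<and> k \<in> {1..n}} \<rparr>"


section \<open>Trees for paths, extended stars and \<open>Yhat\<close>\<close>

text \<open>
  A path is the list of its vertices.  After rule (2) with \<open>p\<close> the first vertex and \<open>v\<close> the
  second, the first three vertices are no longer available.
\<close>
fun peel :: "'v list \<Rightarrow> 'v mtree" where
  "peel [] = Leaf"
| "peel [p] = Free p"
| "peel (p # v # xs) = Match p v (peel (tl xs))"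

text \<open>As \<open>peel\<close>, but either end vertex may be chosen in each step.\<close>
inductive path_tree :: "'v list \<Rightarrow> 'v mtree \<Rightarrow> bool" where
  empty: "path_tree [] Leaf"
| isolated: "path_tree [p] (Free p)"
| end_vertex: "path_tree (tl xs) t \<Longrightarrow> path_tree (p # v # xs) (Match p v t)"
| reverse: "path_tree (rev xs) t \<Longrightarrow> path_tree xs t"

inductive paths_tree :: "'v list list \<Rightarrow> 'v mtree \<Rightarrow> bool" where
  Nil: "paths_tree [] Leaf"
| Cons: "path_tree xs t \<Longrightarrow> paths_tree xss u \<Longrightarrow> paths_tree (xs # xss) (graft t u)"

definition tendril :: "nat \<Rightarrow> nat \<Rightarrow> nat \<Rightarrow> vertex list" where
  "tendril i n j = map (Tendril j) [i..<Suc n]"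

text \<open>An order in which the \<open>m\<close> tendrils are treated.\<close>
definition tendril_order :: "nat \<Rightarrow> nat list \<Rightarrow> bool" where
  "tendril_order m js \<longleftrightarrow> distinct js \<and> set js = {1..m}"

text \<open>
  Trees for the extended star with centre \<open>End_a\<close> and tendrils of vertices
  \<open>Tendril j 1, \<dots>, Tendril j n\<close>.
\<close>
inductive Y_tree :: "nat \<Rightarrow> nat \<Rightarrow> vertex mtree \<Rightarrow> bool" where
  mod_0: "n mod 3 = 0 \<Longrightarrow> tendril_order m js \<Longrightarrow>
    Y_tree m n (foldr (\<lambda>j. graft (peel (rev (tendril 1 n j)))) js (Free End_a))"
| mod_12: "n mod 3 \<noteq> 0 \<Longrightarrow> tendril_order m js \<Longrightarrow> tendril_order m js' \<Longrightarrow>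
    paths_tree (map (tendril 1 n) js) t0 \<Longrightarrow> paths_tree (map (tendril 2 n) js') t1 \<Longrightarrow>
    Y_tree m n (Split End_a t0 t1)"

inductive Yhat_tree :: "nat \<Rightarrow> nat \<Rightarrow> vertex mtree \<Rightarrow> bool" where
  "n \<ge> 1 \<Longrightarrow> Y_tree m n t0 \<Longrightarrow> Y_tree m (n - 1) t1 \<Longrightarrow> Yhat_tree m n (Split End_b t0 t1)"


section \<open>The Comb Algorithm\<close>

text \<open>
  At \<open>\<Sigma>({k}, N(k) \<union> {1..k-1})\<close> the component of the available graph containing \<open>b\<close> is the image
  of \<open>Delta m (n - (k + 1))\<close> under \<open>shift k\<close>: the spine vertex \<open>k + 1\<close> has lost its neighbours
  \<open>(j, k + 1)\<close> and takes the role of \<open>a\<close>.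
\<close>
fun shift :: "nat \<Rightarrow> vertex \<Rightarrow> vertex" where
  "shift k End_a = Spine (k + 1)"
| "shift k End_b = End_b"
| "shift k (Tendril j i) = Tendril j (i + (k + 1))"
| "shift k (Spine i) = Spine (i + (k + 1))"

text \<open>
  \<open>comb_branch m n k\<close> holds of the subtrees at \<open>\<Sigma>({k}, N(k) \<union> {1..k-1})\<close>.
\<close>
inductive comb_tree :: "nat \<Rightarrow> nat \<Rightarrow> vertex mtree \<Rightarrow> bool"
  and comb_branch :: "nat \<Rightarrow> nat \<Rightarrow> nat \<Rightarrow> vertex mtree \<Rightarrow> bool" where
  zero: "Yhat_tree m 1 t \<Longrightarrow> comb_tree m 0 t"
| pos: "n \<ge> 1 \<Longrightarrow> (\<forall>k\<in>{1..n}. comb_branch m n k (br k)) \<Longrightarrow> Yhat_tree m (n + 1) t \<Longrightarrow>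
    comb_tree m n (foldr (\<lambda>k r. Split (Spine k) r (br k)) [1..<Suc n] t)"
| first: "comb_branch m n 1 (Free End_a)"
| last: "comb_branch m n n (Free End_b)"
| middle: "2 \<le> k \<Longrightarrow> k \<le> n - 1 \<Longrightarrow> Y_tree m (k - 1) s \<Longrightarrow> comb_tree m (n - (k + 1)) t \<Longrightarrow>
    comb_branch m n k (graft s (map_mtree (shift k) t))"


section \<open>The cell complexes\<close>

text \<open>
  The number of \<open>d\<close>-cells of the Morse complex of a matching tree; the summand for \<open>d = 0\<close>
  is the base \<open>0\<close>-cell.
\<close>
definition morse_cells :: "'v graph \<Rightarrow> 'v mtree \<Rightarrow> nat \<Rightarrow> nat" where
  "morse_cells G t d =
     card {I \<in> critical_cells G {} {} t. face_dim I = int d} + (if d = 0 then 1 else 0)"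

text \<open>
  The number of \<open>d\<close>-cells of the complex for \<open>Delta m n\<close>, given a tree \<open>T n\<close> for each \<open>n \<ge> 1\<close>;
  for \<open>n = 0\<close> the complex is the sphere with two \<open>0\<close>-cells, by convention.
\<close>
definition X_cells :: "nat \<Rightarrow> (nat \<Rightarrow> vertex mtree) \<Rightarrow> nat \<Rightarrow> nat \<Rightarrow> nat" where
  "X_cells m T n d =
     (if n = 0 then (if d = 0 then 2 else 0) else morse_cells (Delta m n) (T n) d)"

definition C_cells :: "nat \<Rightarrow> (nat \<Rightarrow> vertex mtree) \<Rightarrow> nat \<Rightarrow> nat \<Rightarrow> nat" where
  "C_cells m T n d = (if d = 0 then X_cells m T n 0 - 1 else X_cells m T n d)"

text \<open>Only finitely many terms of the alternating sum over all \<open>d \<ge> 0\<close> are nonzero.\<close>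
definition chi :: "nat \<Rightarrow> (nat \<Rightarrow> vertex mtree) \<Rightarrow> nat \<Rightarrow> int" where
  "chi m T n = (\<Sum>d | C_cells m T n d \<noteq> 0. (- 1) ^ d * int (C_cells m T n d))"


section \<open>The trees of the Comb Algorithm exist and are matching trees\<close>

text \<open>
  \<open>runs N U W t\<close>: the rules of \<open>t\<close> are applicable when the available graph has vertex set \<open>U\<close>
  and neighbourhoods \<open>N\<close>, and the available vertex set at every nonempty leaf is \<open>W\<close>.
\<close>
fun runs :: "('v \<Rightarrow> 'v set) \<Rightarrow> 'v set \<Rightarrow> 'v set \<Rightarrow> 'v mtree \<Rightarrow> bool" where
  "runs N U W Leaf \<longleftrightarrow> U = W"
| "runs N U W (Free p) \<longleftrightarrow> p \<in> U \<and> N p \<inter> U = {}"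
| "runs N U W (Match p v t) \<longleftrightarrow> p \<in> U \<and> N p \<inter> U = {v} \<and> runs N (U - insert v (N v)) W t"
| "runs N U W (Split v t0 t1) \<longleftrightarrow> v \<in> U \<and> runs N (U - {v}) W t0 \<and> runs N (U - insert v (N v)) W t1"

lemma runs_graft: "runs N U W t \<Longrightarrow> runs N W W' s \<Longrightarrow> runs N U W' (graft t s)"
  by (induction t arbitrary: U) auto

lemma graft_assoc: "graft (graft a b) c = graft a (graft b c)"
  by (induction a) auto

lemma runs_map:
  assumes "runs N U {} t" "inj_on f U"
    "\<And>x y. x \<in> U \<Longrightarrow> y \<in> U \<Longrightarrow> f y \<in> H (f x) \<longleftrightarrow> y \<in> N x"
  shows "runs H (f ` U) {} (map_mtree f t)"
  using assms
proof (induction t arbitrary: U)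
  case (Match p v t)
  have v: "v \<in> U" using Match.prems by auto
  have eq: "f ` U - insert (f v) (H (f v)) = f ` (U - insert v (N v))"
    using Match.prems(3)[OF v] Match.prems(2) v by (auto simp: inj_on_def)
  have "runs H (f ` (U - insert v (N v))) {} (map_mtree f t)"
    by (rule Match.IH) (use Match.prems in \<open>auto simp: inj_on_def\<close>)
  moreover have "y \<in> N p \<longleftrightarrow> y = v" if "y \<in> U" for y using Match.prems(1) v that by auto
  then have "H (f p) \<inter> f ` U = {f v}" using Match.prems(1) Match.prems(3)[of p] v
    by (simp add: set_eq_iff image_iff) metis
  ultimately show ?case using Match.prems eq by auto
next
  case (Split v t0 t1)
  have v: "v \<in> U" using Split.prems by auto
  have eq: "f ` U - insert (f v) (H (f v)) = f ` (U - insert v (N v))"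
    using Split.prems(3)[OF v] Split.prems(2) v by (auto simp: inj_on_def)
  have eq': "f ` U - {f v} = f ` (U - {v})"
    using Split.prems(2) v by (auto simp: inj_on_def)
  have "runs H (f ` (U - insert v (N v))) {} (map_mtree f t1)"
    by (rule Split.IH) (use Split.prems in \<open>auto simp: inj_on_def\<close>)
  moreover have "runs H (f ` (U - {v})) {} (map_mtree f t0)"
    by (rule Split.IH) (use Split.prems in \<open>auto simp: inj_on_def\<close>)
  ultimately show ?case using v eq eq' by auto
qed auto

lemma runs_matching_tree:
  assumes "simple_graph G" "A \<in> Ind G" "A \<inter> B = {}" "\<And>v. v \<in> A \<Longrightarrow> nbrs G v \<subseteq> B"
    "runs (nbrs G) (available G A B) {} t"
  shows "matching_tree G A B t"
  using assms(2-)
proof (induction t arbitrary: A B)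
  have sym: "q \<in> nbrs G p \<longleftrightarrow> p \<in> nbrs G q" for p q by (auto simp: nbrs_def insert_commute)
  have irr: "p \<notin> nbrs G p" for p
    using assms(1) by (auto simp: nbrs_def simple_graph_def)
  have fin: "finite (Sigma_cells G A B)" for A B
    by (rule finite_subset[of _ "Pow (verts G)"])
       (use assms(1) in \<open>auto simp: simple_graph_def Sigma_cells_def Ind_def\<close>)
  have disj: "A \<inter> nbrs G v = {}" if "\<And>v. v \<in> A \<Longrightarrow> nbrs G v \<subseteq> B" "v \<in> available G A B" for v A B
    using that(1) that(2) sym unfolding available_def by blast
  have IndI: "insert v A \<in> Ind G" if "A \<in> Ind G" "A \<inter> B = {}" "\<And>v. v \<in> A \<Longrightarrow> nbrs G v \<subseteq> B"
    "v \<in> available G A B" for v A B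
  proof -
    have "\<forall>q\<in>A. {v, q} \<notin> edges G \<and> {q, v} \<notin> edges G"
      using disj[OF that(3,4)] by (auto simp: nbrs_def insert_commute)
    moreover have "{v, v} \<notin> edges G" using irr[of v] by (simp add: nbrs_def)
    ultimately show ?thesis using that(1,4) by (simp add: Ind_def available_def)
  qed
  have two: "2 \<le> card (Sigma_cells G A B)"
    if "A \<in> Ind G" "A \<inter> B = {}" "\<And>v. v \<in> A \<Longrightarrow> nbrs G v \<subseteq> B" "v \<in> available G A B" for v A B
  proof -
    have "{A, insert v A} \<subseteq> Sigma_cells G A B"
      using that IndI[OF that] by (auto simp: Sigma_cells_def available_def)
    moreover have "card {A, insert v A} = 2" using that(4) by (auto simp: available_def card_insert_if)
    ultimately show ?thesis using card_mono[OF fin] by metis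
  qed
  {
    case Leaf
    have "Sigma_cells G A B \<subseteq> {A}"
      using Leaf by (auto simp: Sigma_cells_def available_def Ind_def)
    then have "card (Sigma_cells G A B) \<le> card {A}" by (intro card_mono) auto
    then show ?case by simp
  next
    case (Free p)
    then show ?case using two[OF Free.prems(1-3), of p] by simp
  next
    case (Match p v t)
    then have v: "v \<in> available G A B" by (simp; blast)
    have "available G (insert v A) (B \<union> nbrs G v) = available G A B - insert v (nbrs G v)"
      by (auto simp: available_def)
    moreover have "insert v A \<inter> (B \<union> nbrs G v) = {}"
      using Match.prems(2) v irr[of v] disj[OF Match.prems(3) v] unfolding available_def by blast
    ultimately have "matching_tree G (insert v A) (B \<union> nbrs G v) t"
    proof (intro Match.IH)
      show "insert v A \<in> Ind G" using IndI[OF Match.prems(1-3) v] .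
      show "nbrs G w \<subseteq> B \<union> nbrs G v" if "w \<in> insert v A" for w
        using Match.prems(3)[of w] that by blast
    qed (use Match.prems(4) in simp_all)
    then show ?case using Match.prems(4) two[OF Match.prems(1-3) v] by simp
  next
    case (Split v t0 t1)
    then have v: "v \<in> available G A B" by (simp; blast)
    have "available G (insert v A) (B \<union> nbrs G v) = available G A B - insert v (nbrs G v)"
      by (auto simp: available_def)
    moreover have "insert v A \<inter> (B \<union> nbrs G v) = {}"
      using Split.prems(2) v irr[of v] disj[OF Split.prems(3) v] unfolding available_def by blast
    ultimately have 1: "matching_tree G (insert v A) (B \<union> nbrs G v) t1"
    proof (intro Split.IH)
      show "insert v A \<in> Ind G" using IndI[OF Split.prems(1-3) v] .
      show "nbrs G w \<subseteq> B \<union> nbrs G v" if "w \<in> insert v A" for w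
        using Split.prems(3)[of w] that by blast
    qed (use Split.prems(4) in simp_all)
    have "available G A (insert v B) = available G A B - {v}"
      by (auto simp: available_def)
    then have "matching_tree G A (insert v B) t0"
    proof (intro Split.IH)
      show "A \<inter> insert v B = {}" using v Split.prems(2) by (auto simp: available_def)
      show "nbrs G w \<subseteq> insert v B" if "w \<in> A" for w using Split.prems(3)[OF that] by blast
    qed (use Split.prems in simp_all)
    then show ?case using 1 v two[OF Split.prems(1-3) v] by simp
  }
qed

text \<open>\<open>xs\<close> is a path component of the graph induced on \<open>U\<close>.\<close>
definition pathcomp :: "('v \<Rightarrow> 'v set) \<Rightarrow> 'v set \<Rightarrow> 'v list \<Rightarrow> bool" where
  "pathcomp N U xs \<longleftrightarrow> distinct xs \<and> set xs \<subseteq> U \<and>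
    (\<forall>i<length xs. N (xs ! i) \<inter> U = {xs ! j | j. j < length xs \<and> (j = Suc i \<or> i = Suc j)})"

lemma pathcomp_rev:
  assumes "pathcomp N U xs" shows "pathcomp N U (rev xs)"
proof -
  let ?l = "length xs"
  have "N (rev xs ! i) \<inter> U = {rev xs ! j | j. j < ?l \<and> (j = Suc i \<or> i = Suc j)}" if i: "i < ?l" for i
  proof -
    have "N (rev xs ! i) \<inter> U = {xs ! j | j. j < ?l \<and> (j = Suc (?l - Suc i) \<or> ?l - Suc i = Suc j)}"
      using assms i by (simp add: rev_nth pathcomp_def)
    also have "\<dots> = {rev xs ! j | j. j < ?l \<and> (j = Suc i \<or> i = Suc j)}" (is "?L = ?R")
    proof (intro equalityI subsetI)
      fix y assume "y \<in> ?L"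
      then obtain j where j: "y = xs ! j" "j < ?l" "j = Suc (?l - Suc i) \<or> ?l - Suc i = Suc j" by auto
      have "?l - Suc (?l - Suc j) = j" using j by simp
      then have "y = rev xs ! (?l - Suc j)" using j(1) i by (subst rev_nth) auto
      moreover have "?l - Suc j < ?l" "?l - Suc j = Suc i \<or> i = Suc (?l - Suc j)" using j(2,3) i by linarith+
      ultimately show "y \<in> ?R" by blast
    next
      fix y assume "y \<in> ?R"
      then obtain j where j: "y = rev xs ! j" "j < ?l" "j = Suc i \<or> i = Suc j" by blast
      then have "y = xs ! (?l - Suc j)" by (simp add: rev_nth)
      moreover have "?l - Suc j < ?l" "?l - Suc j = Suc (?l - Suc i) \<or> ?l - Suc i = Suc (?l - Suc j)"
        using j(2,3) i by linarith+
      ultimately show "y \<in> ?L" by blast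
    qed
    finally show ?thesis .
  qed
  then show ?thesis using assms by (auto simp: pathcomp_def)
qed

lemma pathcomp_nth:
  assumes "pathcomp N U xs" "i < length xs"
  shows "N (xs ! i) \<inter> U = {xs ! j | j. j < length xs \<and> (j = Suc i \<or> i = Suc j)}"
  using assms by (auto simp: pathcomp_def)

lemma pathcomp_step:
  assumes P: "pathcomp N U (p # v # xs)"
  shows "p \<in> U" "N p \<inter> U = {v}" "N v \<inter> U = insert p (set (take 1 xs))"
    "U - insert v (N v) = U - set (p # v # take 1 xs)"
    "pathcomp N (U - insert v (N v)) (tl xs)"
proof -
  show "p \<in> U" using P by (auto simp: pathcomp_def)
  show "N p \<inter> U = {v}" using pathcomp_nth[OF P, of 0] by (auto simp: nth_Cons')
  have "{(p # v # xs) ! j | j. j < length (p # v # xs) \<and> (j = Suc 1 \<or> 1 = Suc j)} = insert p (set (take 1 xs))"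
    by (cases xs) (auto simp: nth_Cons')
  then show 3: "N v \<inter> U = insert p (set (take 1 xs))"
    using pathcomp_nth[OF P, of 1] by simp
  show 4: "U - insert v (N v) = U - set (p # v # take 1 xs)" using 3 by auto
  show "pathcomp N (U - insert v (N v)) (tl xs)"
    unfolding 4
  proof (cases xs)
    case Nil then show "pathcomp N (U - set (p # v # take 1 xs)) (tl xs)" by (auto simp: pathcomp_def)
  next
    case (Cons w ys)
    have d: "distinct (p # v # w # ys)" "set ys \<subseteq> U" using P Cons by (auto simp: pathcomp_def)
    have "N (ys ! i) \<inter> (U - {p,v,w}) = {ys ! j | j. j < length ys \<and> (j = Suc i \<or> i = Suc j)}"
      (is "_ = ?R") if i: "i < length ys" for i
    proof -
      have "N (ys ! i) \<inter> U = {(p # v # w # ys) ! j | j. j < length (p # v # w # ys) \<and> (j = Suc (i+3) \<or> i+3 = Suc j)}" 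
        (is "_ = ?S")
        using pathcomp_nth[OF P, of "i+3"] i unfolding Cons by (simp add: numeral_3_eq_3)
      moreover have "?S - {p,v,w} = ?R"
      proof (intro equalityI subsetI)
        fix y assume y: "y \<in> ?S - {p,v,w}"
        then obtain j where j: "y = (p # v # w # ys) ! j" "j < length (p # v # w # ys)" "j = Suc (i+3) \<or> i+3 = Suc j" by blast
        have yn: "y \<noteq> p" "y \<noteq> v" "y \<noteq> w" using y by blast+
        have "j \<noteq> 0" using yn(1) unfolding j(1) by (cases "j = 0") simp_all
        moreover have "j \<noteq> 1" using yn(2) unfolding j(1) by (cases "j = 1") simp_all
        moreover have "j \<noteq> 2" using yn(3) unfolding j(1) by (cases "j = 2") simp_all
        ultimately have "3 \<le> j" by linarith
        define k where "k = j - 3"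
        have k: "j = Suc (Suc (Suc k))" using \<open>3 \<le> j\<close> by (simp add: k_def)
        have "y = ys ! k" using j(1) unfolding k by simp
        moreover have "k < length ys" using j(2) unfolding k by simp
        moreover have "k = Suc i \<or> i = Suc k" using j(3) unfolding k by linarith
        ultimately show "y \<in> ?R" by (intro CollectI exI conjI)
      next
        fix y assume "y \<in> ?R"
        then obtain j where j: "y = ys ! j" "j < length ys" "j = Suc i \<or> i = Suc j" by blast
        have "y \<in> set ys" using j by simp
        then have "y \<notin> {p,v,w}" using d(1) by (metis distinct.simps(2) empty_iff insert_iff list.set_intros(2))
        moreover have "y = (p # v # w # ys) ! Suc (Suc (Suc j))" using j by simp
        moreover have "Suc (Suc (Suc j)) < length (p # v # w # ys)" using j by simp
        moreover have "Suc (Suc (Suc j)) = Suc (i+3) \<or> i+3 = Suc (Suc (Suc (Suc j)))" using j(3) by linarith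
        ultimately show "y \<in> ?S - {p,v,w}" by (intro DiffI CollectI exI conjI)
      qed
      ultimately show ?thesis by (simp only: Int_Diff[symmetric])
    qed
    moreover have "distinct ys" "set ys \<subseteq> U - {p, v, w}" using d by auto
    ultimately show "pathcomp N (U - set (p # v # take 1 xs)) (tl xs)" by (simp add: pathcomp_def Cons)
  qed
qed

lemma set_tl_take: "set xs = set (take 1 xs) \<union> set (tl xs)" by (cases xs) auto

lemma runs_path_tree:
  "path_tree xs t \<Longrightarrow> pathcomp N U xs \<Longrightarrow> runs N U (U - set xs) t"
proof (induction arbitrary: U rule: path_tree.induct)
  case (isolated p)
  then show ?case by (auto simp: pathcomp_def)
next
  case (end_vertex xs t p v)
  note s = pathcomp_step[OF end_vertex.prems]
  have "U - insert v (N v) - set (tl xs) = U - set (p # v # xs)"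
    unfolding s(4) using set_tl_take[of xs] by auto
  then show ?case using end_vertex.IH[OF s(5)] s by auto
next
  case (reverse xs t)
  then show ?case using pathcomp_rev by fastforce
qed auto

lemma path_tree_peel: "path_tree xs (peel xs)"
  by (induction xs rule: peel.induct) (auto intro: path_tree.intros)

lemma pathcomp_remove:
  assumes "pathcomp N U xs" "S \<inter> set xs = {}"
  shows "pathcomp N (U - S) xs"
proof -
  have "N (xs ! i) \<inter> (U - S) = N (xs ! i) \<inter> U" if "i < length xs" for i
    using pathcomp_nth[OF assms(1) that] assms(2) by (auto dest: nth_mem)
  then show ?thesis using assms by (auto simp: pathcomp_def)
qed

lemma runs_paths_tree:
  "paths_tree xss t \<Longrightarrow> (\<And>xs. xs \<in> set xss \<Longrightarrow> pathcomp N U xs) \<Longrightarrow> distinct (concat xss) \<Longrightarrow>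
   runs N U (U - set (concat xss)) t"
proof (induction arbitrary: U rule: paths_tree.induct)
  case (Cons xs t xss u)
  have "runs N U (U - set xs) t" using Cons by (intro runs_path_tree) auto
  moreover have "runs N (U - set xs) (U - set xs - set (concat xss)) u"
    by (rule Cons.IH) (use Cons.prems in \<open>auto intro!: pathcomp_remove\<close>)
  ultimately show ?case by (auto intro: runs_graft simp: Diff_Un Diff_eq Int_assoc)
qed auto


lemma tree_exists_path: "\<exists>t. path_tree xs t" using path_tree_peel by blast

lemma tree_exists_paths: "\<exists>t. paths_tree xss t"
proof (induction xss)
  case (Cons xs xss)
  then show ?case using path_tree_peel[of xs] by (blast intro: paths_tree.Cons)
qed (blast intro: paths_tree.Nil)

lemma tree_exists_Y: "\<exists>t. Y_tree m n t"
proof -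
  have "tendril_order m [1..<Suc m]" by (auto simp: tendril_order_def)
  moreover obtain t0 t1 where "paths_tree (map (tendril 1 n) [1..<Suc m]) t0"
    "paths_tree (map (tendril 2 n) [1..<Suc m]) t1" using tree_exists_paths by metis
  ultimately have "Y_tree m n (if n mod 3 = 0 then foldr (\<lambda>j. graft (peel (rev (tendril 1 n j)))) [1..<Suc m] (Free End_a)
    else Split End_a t0 t1)"
    by (cases "n mod 3 = 0") (simp_all add: Y_tree.mod_0 Y_tree.mod_12 del: upt_Suc One_nat_def)
  then show ?thesis by blast
qed

lemma tree_exists_Yhat: "n \<ge> 1 \<Longrightarrow> \<exists>t. Yhat_tree m n t"
  using tree_exists_Y Yhat_tree.intros by meson

lemma tree_exists_comb: "\<exists>t. comb_tree m n t"
proof (induction n rule: less_induct)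
  case (less n)
  show ?case
  proof (cases "n = 0")
    case True
    then show ?thesis using tree_exists_Yhat comb_tree_comb_branch.zero by (metis order_refl)
  next
    case False
    have "\<exists>t. comb_branch m n k t" if "k \<in> {1..n}" for k
    proof -
      consider "k = 1" | "k = n" | "2 \<le> k" "k \<le> n - 1" using \<open>k \<in> _\<close> by force
      then show ?thesis
      proof cases
        case 1 then show ?thesis using comb_tree_comb_branch.first by blast
      next
        case 2 then show ?thesis using comb_tree_comb_branch.last by blast
      next
        case 3
        then have "n - (k + 1) < n" using False by simp
        then obtain t where "comb_tree m (n - (k + 1)) t" using less by blast
        moreover obtain s where "Y_tree m (k - 1) s" using tree_exists_Y by blast
        ultimately show ?thesis using 3 comb_tree_comb_branch.middle by blast
      qed
    qed
    then obtain br where "\<forall>k\<in>{1..n}. comb_branch m n k (br k)" by metis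
    moreover obtain t where "Yhat_tree m (n + 1) t" using tree_exists_Yhat by (metis le_add2)
    ultimately have "comb_tree m n (foldr (\<lambda>k r. Split (Spine k) r (br k)) [1..<Suc n] t)"
      using False by (intro comb_tree_comb_branch.pos) auto
    then show ?thesis by blast
  qed
qed

lemma runs_peel:
  assumes "\<And>i. i \<in> {1..3*q} \<Longrightarrow> Tendril j i \<in> U"
    "\<And>i. i \<in> {2..3*q} \<Longrightarrow> N (Tendril j i) \<inter> U = Tendril j ` {k \<in> {1..3*q}. k = i + 1 \<or> i = k + 1}"
  shows "runs N U (U - Tendril j ` {1..3*q}) (peel (rev (tendril 1 (3*q) j)))"
  using assms
proof (induction q arbitrary: U)
  case 0 then show ?case by (simp add: tendril_def)
next
  case (Suc q)
  let ?p = "Tendril j (3*q+3)" and ?v = "Tendril j (3*q+2)" and ?w = "Tendril j (3*q+1)"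
  have e: "rev (tendril 1 (3 * Suc q) j) = ?p # ?v # ?w # rev (tendril 1 (3*q) j)"
  proof -
    have "[1..<Suc (3 * Suc q)] = [1..<Suc (3*q)] @ [3*q+1, 3*q+2, 3*q+3]"
      using upt_add_eq_append[of 1 "Suc (3*q)" 3] by (simp add: numeral_3_eq_3)
    then show ?thesis unfolding tendril_def by simp
  qed
  have p: "N ?p \<inter> U = {?v}"
  proof -
    have "{k \<in> {1..3*Suc q}. k = (3*q+3) + 1 \<or> 3*q+3 = k + 1} = {3*q+2}" by auto
    then show ?thesis using Suc.prems(2)[of "3*q+3"] by simp
  qed
  have v: "N ?v \<inter> U = {?p, ?w}"
  proof -
    have "{k \<in> {1..3*Suc q}. k = (3*q+2) + 1 \<or> 3*q+2 = k + 1} = {3*q+3, 3*q+1}" by auto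
    then show ?thesis using Suc.prems(2)[of "3*q+2"] by simp
  qed
  have U': "U - insert ?v (N ?v) = U - {?p,?v,?w}" using v by auto
  have "{1..3 * Suc q} = insert (3*q+3) (insert (3*q+2) (insert (3*q+1) {1..3*q}))" by auto
  then have W: "U - Tendril j ` {1..3 * Suc q} = U - {?p,?v,?w} - Tendril j ` {1..3*q}"
    by (simp only: image_insert) blast
  have "runs N (U - {?p,?v,?w}) (U - {?p,?v,?w} - Tendril j ` {1..3*q}) (peel (rev (tendril 1 (3*q) j)))"
  proof (rule Suc.IH)
    fix i assume "i \<in> {1..3*q}" then show "Tendril j i \<in> U - {?p,?v,?w}" using Suc.prems(1)[of i] by auto
  next
    fix i assume i: "i \<in> {2..3*q}"
    have "N (Tendril j i) \<inter> (U - {?p,?v,?w}) = Tendril j ` {k \<in> {1..3*Suc q}. k = i + 1 \<or> i = k + 1} - {?p,?v,?w}"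
      using Suc.prems(2)[of i] i by auto
    also have "\<dots> = Tendril j ` {k \<in> {1..3*q}. k = i + 1 \<or> i = k + 1}"
      using i by auto 
    finally show "N (Tendril j i) \<inter> (U - {?p,?v,?w}) = Tendril j ` {k \<in> {1..3*q}. k = i + 1 \<or> i = k + 1}" .
  qed
  moreover have "?p \<in> U" using Suc.prems(1)[of "3*q+3"] by auto
  ultimately show ?case using p unfolding W e by (simp only: U' peel.simps runs.simps list.sel simp_thms)
qed

lemma runs_peels:
  assumes "distinct js" "End_a \<in> U"
    "\<And>j i. j \<in> set js \<Longrightarrow> i \<in> {1..3*q} \<Longrightarrow> Tendril j i \<in> U"
    "\<And>j i. j \<in> set js \<Longrightarrow> i \<in> {2..3*q} \<Longrightarrow>
       N (Tendril j i) \<inter> U = Tendril j ` {k \<in> {1..3*q}. k = i + 1 \<or> i = k + 1}"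
    "N End_a \<inter> U \<subseteq> {Tendril j i | j i. j \<in> set js \<and> i \<in> {1..3*q}}"
  shows "runs N U W (foldr (\<lambda>j. graft (peel (rev (tendril 1 (3*q) j)))) js (Free End_a))"
  using assms
proof (induction js arbitrary: U)
  case (Cons j js)
  let ?U = "U - Tendril j ` {1..3*q}"
  have "runs N U ?U (peel (rev (tendril 1 (3*q) j)))" by (rule runs_peel) (use Cons.prems in auto)
  moreover have "runs N ?U W (foldr (\<lambda>j. graft (peel (rev (tendril 1 (3*q) j)))) js (Free End_a))"
  proof (rule Cons.IH)
    fix j' i assume a: "j' \<in> set js" "i \<in> {2..3*q}"
    have "N (Tendril j' i) \<inter> U = Tendril j' ` {k \<in> {1..3*q}. k = i + 1 \<or> i = k + 1}"
      using a Cons.prems(4)[of j' i] by auto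
    moreover have "j \<noteq> j'" using a Cons.prems by auto
    ultimately show "N (Tendril j' i) \<inter> ?U = Tendril j' ` {k \<in> {1..3*q}. k = i + 1 \<or> i = k + 1}"
      by auto
  next
    show "N End_a \<inter> ?U \<subseteq> {Tendril j i | j i. j \<in> set js \<and> i \<in> {1..3*q}}"
      using Cons.prems(5) by auto
  qed (use Cons.prems in auto)
  ultimately show ?case by (auto intro: runs_graft)
qed auto

lemma pathcomp_tendril:
  assumes "\<And>i. i \<in> {a..n} \<Longrightarrow> Tendril j i \<in> U"
    "\<And>i. i \<in> {a..n} \<Longrightarrow> N (Tendril j i) \<inter> U = Tendril j ` {k \<in> {a..n}. k = i + 1 \<or> i = k + 1}"
  shows "pathcomp N U (tendril a n j)"
proof -
  have "N (Tendril j (a + i)) \<inter> U = {Tendril j (a + l) | l. a + l \<le> n \<and> (l = Suc i \<or> i = Suc l)}"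
    if "a + i \<le> n" for i
  proof -
    have "N (Tendril j (a + i)) \<inter> U = Tendril j ` {k \<in> {a..n}. k = (a + i) + 1 \<or> (a + i) = k + 1}"
      using that by (intro assms) auto
    also have "{k \<in> {a..n}. k = (a + i) + 1 \<or> (a + i) = k + 1} = (\<lambda>l. a + l) ` {l. a + l \<le> n \<and> (l = Suc i \<or> i = Suc l)}"
      by (auto simp: image_iff) presburger+
    finally show ?thesis by auto
  qed
  moreover have "(i < Suc n - a) = (a + i \<le> n)" for i by auto
  moreover have nth: "tendril a n j ! i = Tendril j (a + i)" if "a + i \<le> n" for i
    using that by (auto simp: tendril_def simp del: upt_Suc)
  moreover have "length (tendril a n j) = Suc n - a" by (simp add: tendril_def del: upt_Suc)
  moreover have "distinct (tendril a n j)" "set (tendril a n j) \<subseteq> U" using assms(1)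
    by (auto simp: tendril_def distinct_map inj_on_def simp del: upt_Suc)
  moreover have "{tendril a n j ! l | l. a + l \<le> n \<and> Q l} = {Tendril j (a + l) | l. a + l \<le> n \<and> Q l}" for Q
    by (intro Collect_cong ex_cong1) (use nth in auto)
  ultimately show ?thesis
    unfolding pathcomp_def by simp
qed

definition starcomp :: "(vertex \<Rightarrow> vertex set) \<Rightarrow> vertex set \<Rightarrow> nat \<Rightarrow> nat \<Rightarrow> bool" where
  "starcomp N U m n \<longleftrightarrow> End_a \<in> U \<and> (\<forall>j\<in>{1..m}. \<forall>i\<in>{1..n}. Tendril j i \<in> U) \<and>
    End_a \<notin> N End_a \<and>
    N End_a \<inter> U = (if n = 0 then {} else {Tendril j 1 | j. j \<in> {1..m}}) \<and>
    (\<forall>j\<in>{1..m}. \<forall>i\<in>{1..n}. N (Tendril j i) \<inter> U =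
       (if i = 1 then {End_a} else {}) \<union> Tendril j ` {k \<in> {1..n}. k = i + 1 \<or> i = k + 1})"

definition starset :: "nat \<Rightarrow> nat \<Rightarrow> vertex set" where
  "starset m n = insert End_a {Tendril j i | j i. j \<in> {1..m} \<and> i \<in> {1..n}}"

lemma set_tendrils: "set (concat (map (tendril a n) js)) = {Tendril j i | j i. j \<in> set js \<and> i \<in> {a..n}}"
  by (auto simp: tendril_def simp del: upt_Suc)

lemma distinct_tendrils: "distinct js \<Longrightarrow> distinct (concat (map (tendril a n) js))"
  by (induction js) (auto simp: tendril_def distinct_map inj_on_def simp del: upt_Suc)

lemma runs_Y:
  assumes "Y_tree m n t" "starcomp N U m n"
  shows "runs N U (U - starset m n) t"
  using assms
proof (induction rule: Y_tree.induct)
  case (mod_0 n m js)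
  then obtain q where q: "n = 3 * q" by auto
  have U: "End_a \<in> U" "\<And>j i. j \<in> {1..m} \<Longrightarrow> i \<in> {1..n} \<Longrightarrow> Tendril j i \<in> U"
    "N End_a \<inter> U = (if n = 0 then {} else {Tendril j 1 | j. j \<in> {1..m}})"
    "\<And>j i. j \<in> {1..m} \<Longrightarrow> i \<in> {1..n} \<Longrightarrow> N (Tendril j i) \<inter> U =
       (if i = 1 then {End_a} else {}) \<union> Tendril j ` {k \<in> {1..n}. k = i + 1 \<or> i = k + 1}"
    using mod_0.prems unfolding starcomp_def by blast+
  have js: "distinct js" "set js = {1..m}" using mod_0 by (auto simp: tendril_order_def)
  show ?case unfolding q
  proof (rule runs_peels)
    fix j i assume "j \<in> set js" "i \<in> {2..3*q}"
    then show "N (Tendril j i) \<inter> U = Tendril j ` {k \<in> {1..3*q}. k = i + 1 \<or> i = k + 1}"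
      using U(4)[of j i] js q by auto
  qed (use U js q in \<open>auto split: if_splits\<close>)
next
  case (mod_12 n m js js' t0 t1)
  have U: "End_a \<in> U" "\<And>j i. j \<in> {1..m} \<Longrightarrow> i \<in> {1..n} \<Longrightarrow> Tendril j i \<in> U"
    "N End_a \<inter> U = (if n = 0 then {} else {Tendril j 1 | j. j \<in> {1..m}})" "End_a \<notin> N End_a"
    "\<And>j i. j \<in> {1..m} \<Longrightarrow> i \<in> {1..n} \<Longrightarrow> N (Tendril j i) \<inter> U =
       (if i = 1 then {End_a} else {}) \<union> Tendril j ` {k \<in> {1..n}. k = i + 1 \<or> i = k + 1}"
    using mod_12.prems unfolding starcomp_def by blast+
  have n: "n > 0" using mod_12 by (cases n) auto
  have js: "distinct js" "set js = {1..m}" "distinct js'" "set js' = {1..m}"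
    using mod_12 by (auto simp: tendril_order_def)
  let ?U0 = "U - {End_a}" and ?U1 = "U - insert End_a (N End_a)"
  have "runs N ?U0 (?U0 - set (concat (map (tendril 1 n) js))) t0"
  proof (rule runs_paths_tree[OF mod_12(4)])
    fix xs assume "xs \<in> set (map (tendril 1 n) js)"
    then obtain j where j: "j \<in> {1..m}" "xs = tendril 1 n j" using js by auto
    have "N (Tendril j i) \<inter> ?U0 = Tendril j ` {k \<in> {1..n}. k = i + 1 \<or> i = k + 1}" if "i \<in> {1..n}" for i
      using U(5)[OF j(1) that] by (auto split: if_splits)
    then show "pathcomp N ?U0 xs" unfolding j using U(2) j(1) by (intro pathcomp_tendril) auto
  qed (use js distinct_tendrils in auto)
  moreover have "?U0 - set (concat (map (tendril 1 n) js)) = U - starset m n"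
    unfolding set_tendrils starset_def js by auto
  moreover have "runs N ?U1 (?U1 - set (concat (map (tendril 2 n) js'))) t1"
  proof (rule runs_paths_tree[OF mod_12(5)])
    fix xs assume "xs \<in> set (map (tendril 2 n) js')"
    then obtain j where j: "j \<in> {1..m}" "xs = tendril 2 n j" using js by auto
    have U1: "?U1 = U - insert End_a {Tendril j 1 | j. j \<in> {1..m}}" using U(3) n by auto
    have "N (Tendril j i) \<inter> ?U1 = Tendril j ` {k \<in> {2..n}. k = i + 1 \<or> i = k + 1}" if "i \<in> {2..n}" for i
    proof -
      have "N (Tendril j i) \<inter> U = Tendril j ` {k \<in> {1..n}. k = i + 1 \<or> i = k + 1}"
        using U(5)[OF j(1), of i] that by auto
      then have "N (Tendril j i) \<inter> ?U1 = Tendril j ` {k \<in> {1..n}. k = i + 1 \<or> i = k + 1} - insert End_a {Tendril j 1 | j. j \<in> {1..m}}"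
        unfolding U1 by auto
      also have "\<dots> = Tendril j ` ({k \<in> {1..n}. k = i + 1 \<or> i = k + 1} - {1})" using j(1) by auto
      also have "{k \<in> {1..n}. k = i + 1 \<or> i = k + 1} - {1} = {k \<in> {2..n}. k = i + 1 \<or> i = k + 1}" by auto
      finally show ?thesis .
    qed
    then show "pathcomp N ?U1 xs" unfolding j using U(2) j(1) unfolding U1 by (intro pathcomp_tendril) auto
  qed (use js distinct_tendrils in auto)
  moreover have "?U1 - set (concat (map (tendril 2 n) js')) = U - starset m n"
  proof -
    have "{Tendril j i | j i. j \<in> {1..m} \<and> i \<in> {1..n}} = {Tendril j 1 | j. j \<in> {1..m}} \<union> {Tendril j i | j i. j \<in> {1..m} \<and> i \<in> {2..n}}"
    proof -
      have "{1..n} = insert 1 {2..n}" using n by auto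
      then show ?thesis by auto
    qed
    moreover have "?U1 = U - insert End_a {Tendril j 1 | j. j \<in> {1..m}}" using U(3) n by auto
    ultimately show ?thesis unfolding set_tendrils starset_def js by auto
  qed
  ultimately show ?case using U(1) by auto
qed


lemma nbrs_Delta [simp]:
  "Tendril j i \<in> nbrs (Delta m n) (Tendril j' i') \<longleftrightarrow>
     j = j' \<and> j \<in> {1..m} \<and> i \<in> {1..n+1} \<and> i' \<in> {1..n+1} \<and> (i = i' + 1 \<or> i' = i + 1)"
  "Tendril j i \<in> nbrs (Delta m n) End_a \<longleftrightarrow> j \<in> {1..m} \<and> i = 1"
  "Tendril j i \<in> nbrs (Delta m n) End_b \<longleftrightarrow> j \<in> {1..m} \<and> i = n + 1"
  "Tendril j i \<in> nbrs (Delta m n) (Spine k) \<longleftrightarrow> j \<in> {1..m} \<and> k \<in> {1..n} \<and> (i = k \<or> i = k + 1)"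
  "End_a \<in> nbrs (Delta m n) (Tendril j i) \<longleftrightarrow> j \<in> {1..m} \<and> i = 1"
  "End_b \<in> nbrs (Delta m n) (Tendril j i) \<longleftrightarrow> j \<in> {1..m} \<and> i = n + 1"
  "Spine k \<in> nbrs (Delta m n) (Tendril j i) \<longleftrightarrow> j \<in> {1..m} \<and> k \<in> {1..n} \<and> (i = k \<or> i = k + 1)"
  "Spine k \<notin> nbrs (Delta m n) (Spine k')"
  "Spine k \<notin> nbrs (Delta m n) End_a" "Spine k \<notin> nbrs (Delta m n) End_b"
  "End_a \<notin> nbrs (Delta m n) (Spine k)" "End_b \<notin> nbrs (Delta m n) (Spine k)"
  "End_a \<notin> nbrs (Delta m n) End_a" "End_a \<notin> nbrs (Delta m n) End_b"
  "End_b \<notin> nbrs (Delta m n) End_a" "End_b \<notin> nbrs (Delta m n) End_b"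
  apply (auto simp: nbrs_def Delta_def Yhat_def doubleton_eq_iff)
  subgoal by (rule exI[of _ j'], rule exI[of _ i']) simp
  subgoal by (rule exI[of _ j'], rule exI[of _ i]) simp
  done

lemma verts_Delta [simp]:
  "End_a \<in> verts (Delta m n)" "End_b \<in> verts (Delta m n)"
  "Tendril j i \<in> verts (Delta m n) \<longleftrightarrow> j \<in> {1..m} \<and> i \<in> {1..n+1}"
  "Spine k \<in> verts (Delta m n) \<longleftrightarrow> k \<in> {1..n}"
  by (auto simp: Delta_def Yhat_def)

lemma simple_Delta: "simple_graph (Delta m n)"
proof -
  have "{Tendril j k | j k. j \<in> {1..m} \<and> k \<in> {1..n + 1}} = (\<lambda>(j,k). Tendril j k) ` ({1..m} \<times> {1..n+1})"
    by auto
  then have "finite (verts (Delta m n))" by (simp add: Delta_def Yhat_def)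
  then show ?thesis by (auto simp: simple_graph_def Delta_def Yhat_def)
qed

lemma starcomp_Delta:
  assumes "l \<le> n + 1" "End_a \<in> U" "\<And>j i. j \<in> {1..m} \<Longrightarrow> i \<in> {1..l} \<Longrightarrow> Tendril j i \<in> U"
    "\<And>j. j \<in> {1..m} \<Longrightarrow> Tendril j (l + 1) \<notin> U" "\<And>k. k \<in> {1..l} \<Longrightarrow> Spine k \<notin> U" "l = n + 1 \<Longrightarrow> End_b \<notin> U"
  shows "starcomp (nbrs (Delta m n)) U m l"
proof -
  have "x \<in> nbrs (Delta m n) End_a \<inter> U \<longleftrightarrow> x \<in> (if l = 0 then {} else {Tendril j 1 | j. j \<in> {1..m}})" for x
    using assms by (cases x) auto
  moreover have "x \<in> nbrs (Delta m n) (Tendril j i) \<inter> U \<longleftrightarrow>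
      x \<in> (if i = 1 then {End_a} else {}) \<union> Tendril j ` {k \<in> {1..l}. k = i + 1 \<or> i = k + 1}"
    if "j \<in> {1..m}" "i \<in> {1..l}" for x i j
  proof (cases x)
    case (Tendril j' i')
    have "i' \<le> l" if "i' \<le> l + 1" "Tendril j i' \<in> U" using that assms(4)[of j] \<open>j \<in> _\<close> 
      by (metis Suc_eq_plus1 le_SucE)
    then show ?thesis using that assms(1) assms(3)[of j i'] Tendril by auto
  next
    case (Spine k)
    then show ?thesis using that assms(5)[of k] assms(1) by (auto, (metis Suc_leD)?)
  qed (use that assms in auto)
  ultimately show ?thesis using assms(2,3) unfolding starcomp_def by (auto simp: set_eq_iff split del: if_split)
qed

lemma runs_Yhat:
  assumes "Yhat_tree m (n + 1) t"
  shows "runs (nbrs (Delta m n)) (verts (Delta m n) - Spine ` {1..n}) {} t"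
proof -
  let ?N = "nbrs (Delta m n)" and ?U = "verts (Delta m n) - Spine ` {1..n}"
  obtain t0 t1 where t: "t = Split End_b t0 t1" "Y_tree m (n + 1) t0" "Y_tree m n t1"
    using assms by (auto elim: Yhat_tree.cases)
  have "x \<in> ?U - {End_b} \<longleftrightarrow> x \<in> starset m (n + 1)" for x by (cases x) (auto simp: starset_def)
  then have 0: "?U - {End_b} = starset m (n + 1)" by blast
  have "x \<in> ?U - insert End_b (?N End_b) \<longleftrightarrow> x \<in> starset m n" for x by (cases x) (auto simp: starset_def)
  then have 1: "?U - insert End_b (?N End_b) = starset m n" by blast
  have "runs ?N (starset m (n + 1)) {} t0"
    using runs_Y[OF t(2), of ?N "starset m (n + 1)"] starcomp_Delta[of "n+1" n "starset m (n+1)" m]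
    by (auto simp: starset_def)
  moreover have "runs ?N (starset m n) {} t1"
    using runs_Y[OF t(3), of ?N "starset m n"] starcomp_Delta[of "n" n "starset m n" m]
    by (auto simp: starset_def)
  ultimately show ?thesis unfolding t(1) by (simp add: 0 1 image_iff flip: One_nat_def)
qed

lemma inj_shift: "inj_on (shift k) (verts (Delta m n))"
proof (rule inj_onI)
  fix x y assume "shift k x = shift k y" "x \<in> verts (Delta m n)" "y \<in> verts (Delta m n)"
  then show "x = y" by (cases x; cases y) auto
qed

definition Ubr :: "nat \<Rightarrow> nat \<Rightarrow> nat \<Rightarrow> vertex set" where
  "Ubr m n k = verts (Delta m n) - Spine ` {1..<k} - insert (Spine k) (nbrs (Delta m n) (Spine k))"

lemma runs_comb_aux:
  "comb_tree m n t \<Longrightarrow> runs (nbrs (Delta m n)) (verts (Delta m n)) {} t"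
  "comb_branch m' n' k t' \<Longrightarrow> k \<in> {1..n'} \<Longrightarrow> runs (nbrs (Delta m' n')) (Ubr m' n' k) {} t'"
proof (induction rule: comb_tree_comb_branch.inducts)
  case (zero m t)
  then show ?case using runs_Yhat[of m 0 t] by simp
next
  case (pos n m br t)
  let ?N = "nbrs (Delta m n)" and ?V = "verts (Delta m n)"
  have "runs ?N (?V - Spine ` {1..<i}) {} (foldr (\<lambda>k r. Split (Spine k) r (br k)) [i..<Suc n] t)"
    if "i \<le> n + 1" "1 \<le> i" for i
    using that
  proof (induction i rule: inc_induct)
    case base
    have "{1..<n+1} = {1..n}" by auto
    then show ?case using runs_Yhat pos by simp
  next
    case (step i)
    have e: "[i..<Suc n] = i # [Suc i..<Suc n]" using step by (simp add: upt_conv_Cons del: upt_Suc)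
    have "?V - Spine ` {1..<i} - {Spine i} = ?V - Spine ` {1..<Suc i}" using step.prems
      by (auto simp: less_Suc_eq)
    moreover have "runs ?N (Ubr m n i) {} (br i)" using pos step by auto
    ultimately show ?case unfolding e using step by (auto simp: Ubr_def Diff_insert2[symmetric])
  qed
  from this[of 1] show ?case by simp
next
  case (first m n)
  have "x \<notin> nbrs (Delta m n) End_a \<inter> Ubr m n 1" for x using first by (cases x) (auto simp: Ubr_def)
  then show ?case by (auto simp: Ubr_def)
next
  case (last m n)
  have "x \<notin> nbrs (Delta m n) End_b \<inter> Ubr m n n" for x using last by (cases x) (auto simp: Ubr_def)
  then show ?case by (auto simp: Ubr_def)
next
  case (middle k n m s t)
  let ?N = "nbrs (Delta m n)" and ?U = "Ubr m n k" and ?R = "shift k ` verts (Delta m (n - (k + 1)))"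
  have k: "2 \<le> k" "k + 1 \<le> n" using middle by auto
  have "runs ?N ?U (?U - starset m (k - 1)) s"
    by (rule runs_Y[OF middle(3)], rule starcomp_Delta) (use k in \<open>auto simp: Ubr_def\<close>)
  moreover have "x \<in> ?U - starset m (k - 1) \<longleftrightarrow> x \<in> ?R" for x
  proof (cases x)
    case End_a
    have "shift k y \<noteq> End_a" for y by (cases y) auto
    then have "x \<notin> ?R" using End_a by (metis imageE)
    then show ?thesis using End_a by (simp add: starset_def)
  next
    case End_b
    then show ?thesis by (auto simp: starset_def Ubr_def intro!: image_eqI[of _ _ End_b])
  next
    case (Tendril j i)
    have eq: "x = shift k y \<longleftrightarrow> i \<ge> k + 1 \<and> y = Tendril j (i - (k + 1))" for y
      using Tendril by (cases y) auto
    have "x \<in> ?R \<longleftrightarrow> i \<ge> k + 1 \<and> Tendril j (i - (k + 1)) \<in> verts (Delta m (n - (k + 1)))"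
      by (simp only: image_iff eq) blast
    moreover have "x \<in> ?U - starset m (k - 1) \<longleftrightarrow> j \<in> {1..m} \<and> i > k + 1 \<and> i \<le> n + 1"
      unfolding Tendril starset_def Ubr_def using k by auto
    ultimately show ?thesis using k by auto
  next
    case (Spine i)
    have eq: "x = shift k y \<longleftrightarrow> i = k + 1 \<and> y = End_a \<or> i \<ge> k + 1 \<and> y = Spine (i - (k + 1))" for y
      using Spine by (cases y) auto
    have "x \<in> ?R \<longleftrightarrow> i = k + 1 \<or> i \<ge> k + 1 \<and> Spine (i - (k + 1)) \<in> verts (Delta m (n - (k + 1)))"
      by (simp only: image_iff eq) (use verts_Delta(1) in blast)
    moreover have "x \<in> ?U - starset m (k - 1) \<longleftrightarrow> i \<ge> k + 1 \<and> i \<le> n"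
      unfolding Spine starset_def Ubr_def using k by auto
    ultimately show ?thesis using k by auto
  qed
  then have "?U - starset m (k - 1) = ?R" by blast
  moreover have "runs ?N ?R {} (map_mtree (shift k) t)"
  proof (rule runs_map[OF middle(5)])
    show "inj_on (shift k) (verts (Delta m (n - (k + 1))))" by (rule inj_shift)
    fix x y assume "x \<in> verts (Delta m (n - (k + 1)))" "y \<in> verts (Delta m (n - (k + 1)))"
    then show "shift k y \<in> ?N (shift k x) \<longleftrightarrow> y \<in> nbrs (Delta m (n - (k + 1))) x"
      using k by (cases x; cases y) auto
  qed
  ultimately show ?case by (auto intro: runs_graft)
qed

lemma comb_tree_matching_tree:
  assumes "comb_tree m n t" shows "matching_tree (Delta m n) {} {} t"
  by (rule runs_matching_tree)
     (use runs_comb_aux(1)[OF assms] simple_Delta in \<open>auto simp: Ind_def available_def\<close>)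

end

(*
  Along a branch of a matching tree the set A grows by one vertex at every rule (2) and at every
  right branch of rule (3), so the signed number of critical cells is computed by a weight on trees
  that turns grafting into multiplication. For even m the signs of the paths disappear in the m-th
  power and the weight of the star Y^m_n only depends on n mod 3; its generating function is
  Y = -x / (1 + x + x^2). The Comb Algorithm then reads C = H - x^2 Y C, where H = Y/x - Y comes from
  the trees of Yhat, and solving for C gives the negative of the claimed rational function.
*)
theory Submission
  imports Defs
begin

section \<open>The signed number of critical cells\<close>

text \<open>The invariant of the nodes of a matching tree. It puts \<open>A\<close> itself into
  \<open>Sigma_cells G A B\<close>, so every \<open>Leaf\<close> that is reached is nonempty and
  contributes exactly the cell \<open>A\<close>.\<close>

definition consistent :: "'v graph \<Rightarrow> 'v set \<Rightarrow> 'v set \<Rightarrow> bool" where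
  "consistent G A B \<longleftrightarrow> A \<in> Ind G \<and> A \<inter> B = {} \<and> (\<forall>v\<in>A. nbrs G v \<subseteq> B)"

lemma consistent_exclude:
  "consistent G A B \<Longrightarrow> v \<in> available G A B \<Longrightarrow> consistent G A (insert v B)"
  by (auto simp: consistent_def available_def)

lemma consistent_include:
  assumes "simple_graph G" "consistent G A B" "v \<in> available G A B"
  shows "consistent G (insert v A) (B \<union> nbrs G v)"
proof -
  have v: "v \<in> verts G" "v \<notin> A" "v \<notin> B" using assms(3) by (auto simp: available_def)
  have irr: "{v, v} \<notin> edges G" using assms(1) by (auto simp: simple_graph_def)
  have no: "{v, q} \<notin> edges G \<and> {q, v} \<notin> edges G" if "q \<in> A" for q
    using that assms(2) v by (auto simp: consistent_def nbrs_def insert_commute)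
  show ?thesis
    using assms(2) v irr no unfolding consistent_def by (auto simp: Ind_def nbrs_def)
qed

lemma consistent_finite: "simple_graph G \<Longrightarrow> consistent G A B \<Longrightarrow> finite A"
  unfolding simple_graph_def consistent_def Ind_def using finite_subset by blast

text \<open>Both labels only grow downwards, and a critical cell is the final \<open>A\<close>. This
  separates the two sides of a \<open>Split\<close> and also gives finiteness.\<close>

lemma critical_cells_sandwich:
  assumes "simple_graph G" "consistent G A B" "matching_tree G A B t" "I \<in> critical_cells G A B t"
  shows "A \<subseteq> I \<and> I \<subseteq> verts G - B"
  using assms(2-)
proof (induction t arbitrary: A B)
  case Leaf
  then show ?case by (auto simp: consistent_def Ind_def split: if_splits)
next
  case (Match p v t)
  then have "v \<in> available G A B" by auto
  then show ?case
    using Match consistent_include[OF assms(1)] by (fastforce simp: available_def)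
next
  case (Split v t0 t1)
  then have v: "v \<in> available G A B" by auto
  have "I \<in> critical_cells G A (insert v B) t0 \<or> I \<in> critical_cells G (insert v A) (B \<union> nbrs G v) t1"
    using Split.prems by auto
  then show ?case
    using Split.IH(1)[OF consistent_exclude[OF Split.prems(1) v]]
      Split.IH(2)[OF consistent_include[OF assms(1) Split.prems(1) v]] Split.prems(2) by auto
qed auto

lemma finite_critical_cells:
  assumes "simple_graph G" "consistent G A B" "matching_tree G A B t"
  shows "finite (critical_cells G A B t)"
proof (rule finite_subset)
  show "critical_cells G A B t \<subseteq> Pow (verts G)" using critical_cells_sandwich[OF assms] by blast
  show "finite (Pow (verts G))" using assms(1) by (simp add: simple_graph_def)
qed

fun weight :: "'v mtree \<Rightarrow> int" where
  "weight Leaf = 1"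
| "weight (Free p) = 0"
| "weight (Match p v t) = - weight t"
| "weight (Split v t0 t1) = weight t0 - weight t1"

lemma weight_graft: "weight (graft t s) = weight t * weight s"
  by (induction t) (auto simp: algebra_simps)

lemma weight_map: "weight (map_mtree f t) = weight t"
  by (induction t) auto

lemma signed_count_critical_cells:
  assumes "simple_graph G" "consistent G A B" "matching_tree G A B t"
  shows "(\<Sum>I\<in>critical_cells G A B t. (- 1) ^ card I) = (- 1) ^ card A * weight t"
  using assms(2-)
proof (induction t arbitrary: A B)
  case Leaf
  then have "A \<in> Sigma_cells G A B" by (auto simp: Sigma_cells_def consistent_def)
  then show ?case by auto
next
  case (Match p v t)
  then have v: "v \<in> available G A B" by auto
  then have "card (insert v A) = Suc (card A)"
    using consistent_finite[OF assms(1) Match.prems(1)] by (simp add: available_def)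
  then show ?case
    using Match.IH[OF consistent_include[OF assms(1) Match.prems(1) v]] Match.prems(2) by simp
next
  case (Split v t0 t1)
  then have v: "v \<in> available G A B"
    and t: "matching_tree G A (insert v B) t0" "matching_tree G (insert v A) (B \<union> nbrs G v) t1" by auto
  note c = consistent_exclude[OF Split.prems(1) v] consistent_include[OF assms(1) Split.prems(1) v]
  have "card (insert v A) = Suc (card A)"
    using v consistent_finite[OF assms(1) Split.prems(1)] by (simp add: available_def)
  \<comment> \<open>Cells on the left avoid \<open>v\<close>, cells on the right contain it.\<close>
  moreover have "critical_cells G A (insert v B) t0 \<inter> critical_cells G (insert v A) (B \<union> nbrs G v) t1 = {}"
    using critical_cells_sandwich[OF assms(1) c(1) t(1)] critical_cells_sandwich[OF assms(1) c(2) t(2)]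
    by blast
  ultimately show ?case
    using Split.IH(1)[OF c(1) t(1)] Split.IH(2)[OF c(2) t(2)] finite_critical_cells[OF assms(1) c(1) t(1)]
      finite_critical_cells[OF assms(1) c(2) t(2)]
    by (simp add: sum.union_disjoint algebra_simps)
qed auto

text \<open>
  A critical cell \<open>\<emptyset>\<close> would have dimension \<open>- 1\<close> and be missed by \<^const>\<open>chi\<close>; it occurs only if
  all rules on the leftmost branch are of type (3).
\<close>
fun matches_left :: "'v mtree \<Rightarrow> bool" where
  "matches_left Leaf \<longleftrightarrow> False"
| "matches_left (Free p) \<longleftrightarrow> True"
| "matches_left (Match p v t) \<longleftrightarrow> True"
| "matches_left (Split v t0 t1) \<longleftrightarrow> matches_left t0"

lemma matches_left_graft: "matches_left (graft t s) \<longleftrightarrow> matches_left t \<or> matches_left s"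
  by (induction t) auto

text \<open>The leftmost branch keeps \<open>A\<close> unchanged until it reaches a
  \<open>Free\<close>, which has no cells, or a \<open>Match\<close>, which adds a vertex; every
  right branch adds a vertex as well.\<close>

lemma root_not_critical:
  assumes "simple_graph G" "consistent G A B" "matching_tree G A B t" "matches_left t"
  shows "A \<notin> critical_cells G A B t"
  using assms(2-)
proof (induction t arbitrary: B)
  case (Match p v t)
  then have v: "v \<in> available G A B" by auto
  then show ?case
    using critical_cells_sandwich[OF assms(1) consistent_include[OF assms(1) Match.prems(1) v]]
      Match.prems(2) by (auto simp: available_def)
next
  case (Split v t0 t1)
  then have v: "v \<in> available G A B" by auto
  then show ?case
    using critical_cells_sandwich[OF assms(1) consistent_include[OF assms(1) Split.prems(1) v]]
      Split.IH(1)[OF consistent_exclude[OF Split.prems(1) v]] Split.prems by (auto simp: available_def)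
qed auto

text \<open>Grouping the cells by dimension reduces this to the signed count; the minus sign comes
  from dimension being cardinality minus one.\<close>

lemma sum_morse_cells:
  assumes "simple_graph G" "matching_tree G {} {} t" "matches_left t"
  defines "c d \<equiv> card {I \<in> critical_cells G {} {} t. face_dim I = int d}"
  shows "(\<Sum>d | c d \<noteq> 0. (- 1) ^ d * int (c d)) = - weight t"
proof -
  let ?K = "critical_cells G {} {} t"
  have con: "consistent G {} {}" by (simp add: consistent_def Ind_def)
  have fin: "finite ?K" using finite_critical_cells[OF assms(1) con assms(2)] .
  have pos: "card I > 0" if "I \<in> ?K" for I
  proof -
    have "finite I"
      using critical_cells_sandwich[OF assms(1) con assms(2) that] assms(1) finite_subset
      by (auto simp: simple_graph_def)
    moreover have "I \<noteq> {}" using root_not_critical[OF assms(1) con assms(2,3)] that by auto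
    ultimately show ?thesis by (simp add: card_gt_0_iff)
  qed
  \<comment> \<open>Truncated subtraction is harmless since no critical cell is empty.\<close>
  have c: "c d = card {I \<in> ?K. card I - 1 = d}" for d
    unfolding c_def face_dim_def by (rule arg_cong[of _ _ card]) (use pos in force)
  have "{d. c d \<noteq> 0} = (\<lambda>I. card I - 1) ` ?K"
    using fin by (auto simp: c)
  then have "(\<Sum>d | c d \<noteq> 0. (- 1) ^ d * int (c d)) =
      (\<Sum>d\<in>(\<lambda>I. card I - 1) ` ?K. \<Sum>I | I \<in> ?K \<and> card I - 1 = d. (- 1) ^ (card I - 1))"
    by (simp add: c mult.commute)
  also have "\<dots> = (\<Sum>I\<in>?K. (- 1) ^ (card I - 1))"
    by (rule sum.image_gen[OF fin, symmetric])
  also have "\<dots> = (\<Sum>I\<in>?K. - ((- 1) ^ card I))"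
  proof (rule sum.cong[OF refl])
    fix I assume "I \<in> ?K"
    then obtain r where "card I = Suc r" using pos gr0_implies_Suc by blast
    then show "(- 1 :: int) ^ (card I - 1) = - ((- 1) ^ card I)" by simp
  qed
  also have "\<dots> = - weight t"
    using signed_count_critical_cells[OF assms(1) con assms(2)] by (simp add: sum_negf)
  finally show ?thesis .
qed


section \<open>Weights of the trees\<close>

text \<open>The independence polynomial of the path on \<open>l\<close> vertices at -1. The
  truncated \<open>l - 1\<close> mirrors \<open>tl [] = []\<close>: a path on two vertices is used
  up by one \<open>Match\<close>.\<close>

fun path_weight :: "nat \<Rightarrow> int" where
  "path_weight 0 = 1"
| "path_weight (Suc 0) = 0"
| "path_weight (Suc (Suc l)) = - path_weight (l - 1)"

lemma path_weight_add_3: "path_weight (l + 3) = - path_weight l"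
  by (simp add: numeral_3_eq_3)

lemma path_weight_mod_3:
  "path_weight (3 * q) = (- 1) ^ q" "path_weight (3 * q + 1) = 0"
  "path_weight (3 * q + 2) = - ((- 1) ^ q)"
proof (induction q)
  case (Suc q)
  show "path_weight (3 * Suc q) = (- 1) ^ Suc q"
    using path_weight_add_3[of "3 * q"] Suc.IH(1) by (simp add: add.commute)
  show "path_weight (3 * Suc q + 1) = 0"
    using path_weight_add_3[of "3 * q + 1"] Suc.IH(2) by (simp add: algebra_simps)
  show "path_weight (3 * Suc q + 2) = - ((- 1) ^ Suc q)"
    using path_weight_add_3[of "3 * q + 2"] Suc.IH(3) by (simp add: algebra_simps)
qed (simp_all add: numeral_2_eq_2)

text \<open>Reversal keeps the length, so the choice of end vertices does not affect the
  weight.\<close>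

lemma weight_path_tree: "path_tree xs t \<Longrightarrow> weight t = path_weight (length xs)"
  by (induction rule: path_tree.induct) auto

lemma weight_paths_tree: "paths_tree xss t \<Longrightarrow> weight t = (\<Prod>xs\<leftarrow>xss. path_weight (length xs))"
  by (induction rule: paths_tree.induct) (auto simp: weight_graft weight_path_tree)

lemma matches_left_path_tree: "path_tree xs t \<Longrightarrow> xs \<noteq> [] \<Longrightarrow> matches_left t"
  by (induction rule: path_tree.induct) auto

lemma matches_left_paths_tree: "paths_tree xss t \<Longrightarrow> \<exists>xs\<in>set xss. xs \<noteq> [] \<Longrightarrow> matches_left t"
  by (induction rule: paths_tree.induct) (auto simp: matches_left_graft matches_left_path_tree)

lemma tendril_order_length: "tendril_order m js \<Longrightarrow> length js = m"
  unfolding tendril_order_def using distinct_card by fastforce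

lemma weight_tendrils:
  assumes "paths_tree (map (tendril i n) js) t" "tendril_order m js"
  shows "weight t = path_weight (Suc n - i) ^ m"
  using weight_paths_tree[OF assms(1)] tendril_order_length[OF assms(2)]
  by (simp add: o_def tendril_def prod_list_replicate map_replicate_const del: upt_Suc)

section \<open>Weights of extended stars\<close>

definition Y_weight :: "nat \<Rightarrow> int" where
  "Y_weight n = (if n mod 3 = 0 then 0 else if n mod 3 = 1 then - 1 else 1)"

text \<open>For residue 0 everything ends in \<open>Free End_a\<close>. Otherwise the weight is a
  difference of \<open>m\<close>-th powers, one of base 0 and one of base 1 or -1; since
  \<open>m\<close> is even and positive, these powers are 0 and 1.\<close>

lemma weight_Y_tree:
  assumes "Y_tree m n t" "m \<ge> 1" "even m"
  shows "weight t = Y_weight n"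
  using assms
proof (induction rule: Y_tree.induct)
  case (mod_0 n m js)
  have "weight (foldr (\<lambda>j. graft (f j)) js (Free End_a)) = 0" for f
    by (induction js) (auto simp: weight_graft)
  then show ?case using mod_0 by (simp add: Y_weight_def)
next
  case (mod_12 n m js js' t0 t1)
  define q where "q = n div 3"
  have "n = 3 * q + 1 \<and> n mod 3 = 1 \<or> n = 3 * q + 2 \<and> n mod 3 = 2"
    using mod_12(1) unfolding q_def by presburger
  then consider "n = 3 * q + 1" "n mod 3 = 1" | "n = 3 * q + 2" "n mod 3 = 2" by blast
  moreover have "((- 1) ^ q) ^ m = (1 :: int)"
    using mod_12.prems by (metis power_mult mult.commute power_minus_even power_one)
  moreover have "(- ((- 1) ^ q)) ^ m = (1 :: int)"
    using calculation(2) mod_12.prems by (simp add: power_minus_even)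
  \<comment> \<open>Including the centre removes the first vertex of every tendril, leaving paths on
    \<open>n - 1\<close> vertices.\<close>
  moreover have "Suc n - 2 = n - 1" by simp
  then have "weight (Split End_a t0 t1) = path_weight n ^ m - path_weight (n - 1) ^ m"
    using weight_tendrils[OF mod_12(4,2)] weight_tendrils[OF mod_12(5,3)] by simp
  ultimately show ?case
    using mod_12.prems path_weight_mod_3[of q] by cases (simp_all add: Y_weight_def power_0_left)
qed

lemma matches_left_Y_tree: "Y_tree m n t \<Longrightarrow> m \<ge> 1 \<Longrightarrow> matches_left t"
proof (induction rule: Y_tree.induct)
  case (mod_0 n m js)
  show ?case by (induction js) (auto simp: matches_left_graft)
next
  case (mod_12 n m js js' t0 t1)
  have "n \<noteq> 0" using mod_12(1) by (cases n) auto
  then have "tendril 1 n j \<noteq> []" for j by (simp add: tendril_def)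
  moreover have "1 \<in> set js" using mod_12 by (auto simp: tendril_order_def)
  ultimately show ?case using matches_left_paths_tree[OF mod_12(4)] by auto
qed

section \<open>Weights and leftmost branches of \<open>Yhat\<close> trees and combs\<close>

lemma weight_Yhat_tree:
  "Yhat_tree m n t \<Longrightarrow> m \<ge> 1 \<Longrightarrow> even m \<Longrightarrow> weight t = Y_weight n - Y_weight (n - 1)"
  by (induction rule: Yhat_tree.induct) (simp add: weight_Y_tree)

lemma matches_left_Yhat_tree: "Yhat_tree m n t \<Longrightarrow> m \<ge> 1 \<Longrightarrow> matches_left t"
  by (induction rule: Yhat_tree.induct) (auto intro: matches_left_Y_tree)

lemma weight_foldr_Split:
  "weight (foldr (\<lambda>k r. Split (f k) r (br k)) ks t) = weight t - (\<Sum>k\<leftarrow>ks. weight (br k))"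
  by (induction ks) auto

text \<open>The leftmost branch of a comb runs through the spine splits into the tree of
  \<open>Yhat\<close>.\<close>

lemma matches_left_comb_tree:
  assumes "comb_tree m n t" "m \<ge> 1" shows "matches_left t"
  using assms(1)
proof (cases rule: comb_tree.cases)
  case zero
  then show ?thesis using matches_left_Yhat_tree assms(2) by blast
next
  case (pos br s)
  have "matches_left (foldr (\<lambda>k r. Split (Spine k) r (br k)) ks s)" for ks
    by (induction ks) (use pos matches_left_Yhat_tree assms(2) in auto)
  then show ?thesis using pos by blast
qed


section \<open>Generating functions\<close>

unbundle fps_syntax

abbreviation (input) "cubic \<equiv> 1 + fps_X + fps_X ^ 2 - fps_X ^ 3 :: rat fps"

text \<open>The expected series of comb weights, fixed in advance by its closed form. It is negated
  because weights carry the sign of the cardinality, not of the dimension.\<close>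

definition comb_fps :: "rat fps" where
  "comb_fps = - ((1 - fps_X) / cubic)"

definition Y_fps :: "rat fps" where
  "Y_fps = Abs_fps (\<lambda>n. of_int (Y_weight n))"

lemma Y_weight_recurrence: "Y_weight (n + 2) + Y_weight (n + 1) + Y_weight n = 0"
proof -
  consider "n mod 3 = 0" | "n mod 3 = 1" | "n mod 3 = 2" by linarith
  then show ?thesis by cases (simp_all add: Y_weight_def mod_Suc numeral_2_eq_2)
qed

text \<open>The three values of a period sum to 0, which clears all coefficients from degree 2 on;
  \<open>Y_weight 0 = 0\<close> and \<open>Y_weight 1 = - 1\<close> give the rest.\<close>

lemma Y_fps_eq: "(1 + fps_X + fps_X ^ 2) * Y_fps = - fps_X"
proof (rule fps_ext)
  fix n :: nat
  have "n = 0 \<or> n = 1 \<or> n = (n - 2) + 2" by linarith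
  then consider "n = 0" | "n = 1" | k where "n = k + 2" by blast
  then show "((1 + fps_X + fps_X ^ 2) * Y_fps) $ n = (- fps_X) $ n"
  proof cases
    case 3
    have "of_int (Y_weight (k + 2) + Y_weight (k + 1) + Y_weight k) = (0 :: rat)"
      by (simp only: Y_weight_recurrence of_int_0)
    then show ?thesis using 3 by (simp add: distrib_right fps_X_power_mult_nth Y_fps_def)
  qed (simp_all add: distrib_right fps_X_power_mult_nth Y_fps_def Y_weight_def)
qed

section \<open>The functional equation and the Comb recursion\<close>

lemma cubic_mult_comb_fps: "cubic * comb_fps = - (1 - fps_X)"
proof -
  have "cubic $ 0 \<noteq> 0" by simp
  then show ?thesis unfolding comb_fps_def by (simp add: fps_divide_unit inverse_mult_eq_1' mult.left_commute)
qed

text \<open>Multiplied by \<open>fps_X\<close> to avoid dividing by it. Multiplying further by the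
  nonzero \<open>?q\<close> replaces \<open>?q * Y_fps\<close> by \<open>- fps_X\<close>, and
  \<open>?q - fps_X ^ 3\<close> is \<open>cubic\<close>.\<close>

lemma comb_fps_eq: "fps_X * comb_fps = (1 - fps_X) * Y_fps - fps_X * (fps_X ^ 2 * (Y_fps * comb_fps))"
proof -
  let ?q = "1 + fps_X + fps_X ^ 2 :: rat fps"
  have "?q * (fps_X * comb_fps - (1 - fps_X) * Y_fps + fps_X * (fps_X ^ 2 * (Y_fps * comb_fps))) =
    fps_X * (?q * comb_fps) - (1 - fps_X) * (?q * Y_fps) + fps_X * fps_X ^ 2 * ((?q * Y_fps) * comb_fps)"
    by (simp add: algebra_simps)
  also have "\<dots> = fps_X * (cubic * comb_fps) + (1 - fps_X) * fps_X"
    unfolding Y_fps_eq by (simp add: algebra_simps power2_eq_square power3_eq_cube)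
  also have "\<dots> = 0" unfolding cubic_mult_comb_fps by (simp add: algebra_simps)
  finally have "?q = 0 \<or> fps_X * comb_fps - (1 - fps_X) * Y_fps + fps_X * (fps_X ^ 2 * (Y_fps * comb_fps)) = 0"
    by (simp only: mult_eq_0_iff)
  moreover have "?q $ 0 \<noteq> 0" by simp
  then have "?q \<noteq> 0" by (metis fps_zero_nth)
  ultimately show ?thesis by (simp add: algebra_simps)
qed

lemma comb_fps_nth:
  "comb_fps $ n = of_int (Y_weight (n + 1) - Y_weight n) -
     (\<Sum>k = 2..n - 1. of_int (Y_weight (k - 1)) * comb_fps $ (n - (k + 1)))"
proof -
  let ?g = "\<lambda>i. of_int (Y_weight i) * comb_fps $ (n - 2 - i)"
  have "comb_fps $ n = (fps_X * comb_fps) $ Suc n" by simp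
  also have "\<dots> = Y_fps $ Suc n - Y_fps $ n - (fps_X ^ 2 * (Y_fps * comb_fps)) $ n"
    by (subst comb_fps_eq) (simp add: left_diff_distrib)
  also have "(fps_X ^ 2 * (Y_fps * comb_fps)) $ n =
    (\<Sum>k = 2..n - 1. of_int (Y_weight (k - 1)) * comb_fps $ (n - (k + 1)))"
  proof (cases "n < 2")
    case False
    have "(fps_X ^ 2 * (Y_fps * comb_fps)) $ n = (\<Sum>i = 0..n - 2. ?g i)"
      using False unfolding fps_X_power_mult_nth by (simp add: fps_mult_nth Y_fps_def)
    \<comment> \<open>The term at 0 vanishes because \<open>Y_weight 0 = 0\<close>; hence the spine
      index \<open>k = i + 1\<close> starts at 2.\<close>
    also have "\<dots> = (\<Sum>i = 1..n - 2. ?g i)"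
      by (simp add: sum.atLeast_Suc_atMost Y_weight_def)
    also have "\<dots> = (\<Sum>k = 2..n - 1. of_int (Y_weight (k - 1)) * comb_fps $ (n - (k + 1)))"
      using False
      by (intro sum.reindex_bij_witness[of _ "\<lambda>k. k - 1" "\<lambda>i. i + 1"]) auto
    finally show ?thesis .
  qed (simp add: fps_X_power_mult_nth)
  finally show ?thesis by (simp add: Y_fps_def)
qed

text \<open>The first and last branches are \<open>Free\<close> and count 0; a middle branch is a
  graft, so its weight is a product. The comb then satisfies the recursion
  \<open>comb_fps_nth\<close>, whose leading difference is the weight of the \<open>Yhat\<close>
  tree.\<close>

lemma weight_comb:
  "comb_tree m n t \<Longrightarrow> m \<ge> 1 \<Longrightarrow> even m \<Longrightarrow> of_int (weight t) = comb_fps $ n"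
  "comb_branch m' n' k t' \<Longrightarrow> m' \<ge> 1 \<Longrightarrow> even m' \<Longrightarrow> of_int (weight t') =
     (if k \<in> {2..n' - 1} then of_int (Y_weight (k - 1)) * comb_fps $ (n' - (k + 1)) else 0)"
proof (induction rule: comb_tree_comb_branch.inducts)
  case (zero m t)
  then show ?case using comb_fps_nth[of 0] weight_Yhat_tree[OF zero(1)] by simp
next
  case (pos n m br t)
  have "of_int (weight (foldr (\<lambda>k r. Split (Spine k) r (br k)) [1..<Suc n] t)) =
      of_int (weight t) - (\<Sum>k = 1..n. of_int (weight (br k)) :: rat)"
    by (simp add: weight_foldr_Split sum_set_upt_conv_sum_list_nat[symmetric] atLeastLessThanSuc_atLeastAtMost
        del: upt_Suc)
  also have "(\<Sum>k = 1..n. of_int (weight (br k)) :: rat) =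
      (\<Sum>k = 1..n. if k \<in> {2..n - 1} then of_int (Y_weight (k - 1)) * comb_fps $ (n - (k + 1)) else 0)"
    using pos by (intro sum.cong) auto
  also have "\<dots> = (\<Sum>k = 2..n - 1. of_int (Y_weight (k - 1)) * comb_fps $ (n - (k + 1)))"
    by (intro sum.mono_neutral_cong_right) auto
  also have "of_int (weight t) - \<dots> = comb_fps $ n"
    using weight_Yhat_tree[OF _ pos.prems] pos.hyps by (subst (2) comb_fps_nth) simp
  finally show ?case .
next
  case (middle k n m s t)
  then show ?case by (simp add: weight_graft weight_map weight_Y_tree)
qed auto

lemma chi_comb:
  assumes "m \<ge> 1" "even m" "\<And>n. n \<ge> 1 \<Longrightarrow> comb_tree m n (T n)"
  shows "of_int (chi m T n) = - comb_fps $ n"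
proof (cases "n = 0")
  case True
  \<comment> \<open>Here the complex is a sphere by convention, not read off a tree.\<close>
  have "chi m T 0 = 1"
    by (simp add: chi_def C_cells_def X_cells_def)
  moreover have "comb_fps $ 0 = - 1" by (subst comb_fps_nth) (simp add: Y_weight_def)
  ultimately show ?thesis using True by simp
next
  case False
  then have T: "comb_tree m n (T n)" using assms by simp
  \<comment> \<open>The base 0-cell is added in \<open>morse_cells\<close> and subtracted again in
    \<open>C_cells\<close>.\<close>
  have "C_cells m T n d = card {I \<in> critical_cells (Delta m n) {} {} (T n). face_dim I = int d}" for d
    using False by (simp add: C_cells_def X_cells_def morse_cells_def)
  then have "chi m T n = - weight (T n)"
    using sum_morse_cells[OF simple_Delta comb_tree_matching_tree[OF T] matches_left_comb_tree[OF T assms(1)]]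
    by (simp add: chi_def)
  then show ?thesis using weight_comb(1)[OF T assms(1,2)] by simp
qed

theorem corollary4p4:
  fixes m :: nat and T :: "nat \<Rightarrow> vertex mtree"
  assumes "m \<ge> 2" and "even m"
    and "\<And>n. n \<ge> 1 \<Longrightarrow> comb_tree m n (T n)"
  shows "chi m T 0 = 1 \<and> chi m T 1 = - 2 \<and> chi m T 2 = 1 \<and>
    (\<forall>n\<ge>3. chi m T n = chi m T (n - 3) - chi m T (n - 2) - chi m T (n - 1)) \<and>
    Abs_fps (\<lambda>n. of_int (chi m T n) :: rat) =
      (1 - fps_X) / (1 + fps_X + fps_X ^ 2 - fps_X ^ 3)"
proof -
  define F where "F = Abs_fps (\<lambda>n. of_int (chi m T n) :: rat)"
  have "F = - comb_fps"
    using chi_comb[OF _ assms(2,3)] assms(1) by (intro fps_ext) (simp add: F_def)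
  then have F: "F = (1 - fps_X) / cubic" and "cubic * F = 1 - fps_X"
    by (simp add: comb_fps_def, simp only: mult_minus_right cubic_mult_comb_fps minus_minus)
  then have nth: "(cubic * F) $ n = (1 - fps_X) $ n" for n by simp
  \<comment> \<open>Comparing coefficients in \<open>cubic * F = 1 - fps_X\<close>: degrees below 3
    give the initial values, all others the recurrence.\<close>
  have nth': "F $ n + (if n < 1 then 0 else F $ (n - 1)) + (if n < 2 then 0 else F $ (n - 2)) -
      (if n < 3 then 0 else F $ (n - 3)) = (if n = 0 then 1 else if n = 1 then - 1 else 0)" for n
    using nth[of n] by (simp add: left_diff_distrib distrib_right fps_X_power_mult_nth)
  have "F $ 0 = 1" "F $ 1 = - 2" "F $ 2 = 1"
    using nth'[of 0] nth'[of 1] nth'[of 2] by simp_all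
  then have "chi m T 0 = 1" "chi m T 1 = - 2" "chi m T 2 = 1"
    unfolding F_def by simp_all
  moreover have "chi m T n = chi m T (n - 3) - chi m T (n - 2) - chi m T (n - 1)" if "n \<ge> 3" for n
  proof -
    have "F $ n = F $ (n - 3) - F $ (n - 2) - F $ (n - 1)"
      using nth'[of n] that by (simp add: algebra_simps)
    then have "of_int (chi m T n) = (of_int (chi m T (n - 3) - chi m T (n - 2) - chi m T (n - 1)) :: rat)"
      unfolding F_def by simp
    then show ?thesis by (simp only: of_int_eq_iff)
  qed
  ultimately show ?thesis using F unfolding F_def by blast
qed

end
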